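(* Let $\mathfrak{g}$ and $\mathfrak{q}$ be two $\mathsf{Lie}$-isoclinic Leibniz algebras. Then $\mathsf{Der}_c^{\mathsf{Lie}}(\mathfrak{g})\cong\mathsf{Der}_c^{\mathsf{Lie}}(\mathfrak{q})$.
   Context: $\mathbb{K}$ is a fixed ground field with $\frac12\in\mathbb{K}$. A Leibniz algebra over $\mathbb{K}$ is a $\mathbb{K}$-vector space $\mathfrak{g}$ with a bilinear bracket satisfying $[x,[y,z]]=[[x,y],z]-[[x,z],y]$ for all $x,y,z$. Put $[x,y]_{lie}=[x,y]+[y,x]$. The $\mathsf{Lie}$-center is $Z_{\mathsf{Lie}}(\mathfrak{g})=\{z\in\mathfrak{g}\mid [g,z]_{lie}=0\ \text{for all } g\in\mathfrak{g}\}$, a two-sided ideal. $[\mathfrak{g},\mathfrak{g}]_{\mathsf{Lie}}$ is the two-sided ideal generated by all $[x,y]_{lie}$, $x,y\in\mathfrak{g}$. A $\mathsf{Lie}$-derivation of $\mathfrak{g}$ is a linear map $d:\mathfrak{g}\to\mathfrak{g}$ with $d([x,y]_{lie})=[d(x),y]_{lie}+[x,d(y)]_{lie}$ for all $x,y$; these form a Lie algebra $\mathsf{Der}^{\mathsf{Lie}}(\mathfrak{g})$ under the commutator $[\alpha,\beta]=\alpha\circ\beta-\beta\circ\alpha$. The set of almost inner $\mathsf{Lie}$-derivations is $\mathsf{Der}_c^{\mathsf{Lie}}(\mathfrak{g})=\{d\in\mathsf{Der}^{\mathsf{Lie}}(\mathfrak{g})\mid d(x)\in[x,\mathfrak{g}]_{lie}\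 \text{for all }x\in\mathfrak{g}\}$, where $[x,\mathfrak{g}]_{lie}=\{[x,y]_{lie}\mid y\in\mathfrak{g}\}$; it is regarded as a Lie subalgebra of $\mathsf{Der}^{\mathsf{Lie}}(\mathfrak{g})$, and $\cong$ denotes isomorphism of Lie algebras. Leibniz algebras $\mathfrak{g}$ and $\mathfrak{q}$ are $\mathsf{Lie}$-isoclinic if there are Leibniz algebra isomorphisms $\eta:\mathfrak{g}/Z_{\mathsf{Lie}}(\mathfrak{g})\to\mathfrak{q}/Z_{\mathsf{Lie}}(\mathfrak{q})$ and $\xi:[\mathfrak{g},\mathfrak{g}]_{\mathsf{Lie}}\to[\mathfrak{q},\mathfrak{q}]_{\mathsf{Lie}}$ such that $\xi([x_1,x_2]_{lie})=[y_1,y_2]_{lie}$ whenever $x_i\in\mathfrak{g}$, $y_i\in\mathfrak{q}$ satisfy $\eta(x_i+Z_{\mathsf{Lie}}(\mathfrak{g}))=y_i+Z_{\mathsf{Lie}}(\mathfrak{q})$, $i=1,2$. *)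

theory Defs
  imports Complex_Main "HOL-Library.Set_Algebras"
begin

section \<open>Leibniz algebras\<close>

locale leibniz_algebra = vector_space scale
  for scale :: "'k::field \<Rightarrow> 'v::ab_group_add \<Rightarrow> 'v" +
  fixes br :: "'v \<Rightarrow> 'v \<Rightarrow> 'v"
  assumes linear_right: "Vector_Spaces.linear scale scale (\<lambda>y. br x y)"
    and linear_left: "Vector_Spaces.linear scale scale (\<lambda>x. br x y)"
    and leibniz_identity: "br x (br y z) = br (br x y) z - br (br x z) y"

definition lie_br :: "('v::ab_group_add \<Rightarrow> 'v \<Rightarrow> 'v) \<Rightarrow> 'v \<Rightarrow> 'v \<Rightarrow> 'v" where
  "lie_br br x y = br x y + br y x"

definition lie_center :: "('v::ab_group_add \<Rightarrow> 'v \<Rightarrow> 'v) \<Rightarrow> 'v set" where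
  "lie_center br = {z. \<forall>g. lie_br br g z = 0}"

definition two_sided_ideal ::
  "('k::field \<Rightarrow> 'v::ab_group_add \<Rightarrow> 'v) \<Rightarrow> ('v \<Rightarrow> 'v \<Rightarrow> 'v) \<Rightarrow> 'v set \<Rightarrow> bool" where
  "two_sided_ideal scale br N \<longleftrightarrow>
     module.subspace scale N \<and> (\<forall>x. \<forall>n\<in>N. br x n \<in> N \<and> br n x \<in> N)"

definition lie_commutator ::
  "('k::field \<Rightarrow> 'v::ab_group_add \<Rightarrow> 'v) \<Rightarrow> ('v \<Rightarrow> 'v \<Rightarrow> 'v) \<Rightarrow> 'v set" where
  "lie_commutator scale br = (two_sided_ideal scale br) hull {lie_br br x y | x y. True}"


section \<open>Algebras on a carrier set, and their isomorphisms\<close>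

record ('k, 'v) alg =
  vecs :: "'v set"
  vadd :: "'v \<Rightarrow> 'v \<Rightarrow> 'v"
  vscale :: "'k \<Rightarrow> 'v \<Rightarrow> 'v"
  vbr :: "'v \<Rightarrow> 'v \<Rightarrow> 'v"

text \<open>
  The second conjunct on brackets holds trivially whenever both carriers are closed under their
  brackets. It is stated so that the notion stays meaningful (and invariant under inverses) if the
  bracket is only partially defined on the carriers, as closure of the set of almost inner
  derivations under commutators is not built into its definition.
\<close>
definition alg_iso :: "('k, 'v) alg \<Rightarrow> ('k, 'w) alg \<Rightarrow> ('v \<Rightarrow> 'w) \<Rightarrow> bool" where
  "alg_iso A B f \<longleftrightarrow>
     bij_betw f (vecs A) (vecs B) \<and>
     (\<forall>x\<in>vecs A. \<forall>y\<in>vecs A. f (vadd A x y) = vadd B (f x) (f y)) \<and>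
     (\<forall>c. \<forall>x\<in>vecs A. f (vscale A c x) = vscale B c (f x)) \<and>
     (\<forall>x\<in>vecs A. \<forall>y\<in>vecs A. f (vbr A x y) = vbr B (f x) (f y)) \<and>
     (\<forall>x\<in>vecs A. \<forall>y\<in>vecs A. vbr A x y \<in> vecs A \<longleftrightarrow> vbr B (f x) (f y) \<in> vecs B)"

definition isomorphic_alg :: "('k, 'v) alg \<Rightarrow> ('k, 'w) alg \<Rightarrow> bool" where
  "isomorphic_alg A B \<longleftrightarrow> (\<exists>f. alg_iso A B f)"

definition sub_alg ::
  "('k::field \<Rightarrow> 'v::ab_group_add \<Rightarrow> 'v) \<Rightarrow> ('v \<Rightarrow> 'v \<Rightarrow> 'v) \<Rightarrow> 'v set \<Rightarrow> ('k, 'v) alg" where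
  "sub_alg scale br S = \<lparr>vecs = S, vadd = (+), vscale = scale, vbr = br\<rparr>"

text \<open>
  For an ideal \<open>N\<close>, the union over all representatives of the cosets of the results is a single
  coset; see the lemmas on \<open>quotient_alg\<close> below.
\<close>
definition quotient_alg ::
  "('k::field \<Rightarrow> 'v::ab_group_add \<Rightarrow> 'v) \<Rightarrow> ('v \<Rightarrow> 'v \<Rightarrow> 'v) \<Rightarrow> 'v set \<Rightarrow> ('k, 'v set) alg" where
  "quotient_alg scale br N =
     \<lparr>vecs = range (\<lambda>x. x +o N),
      vadd = (\<lambda>X Y. \<Union>x\<in>X. \<Union>y\<in>Y. (x + y) +o N),
      vscale = (\<lambda>c X. \<Union>x\<in>X. scale c x +o N),
      vbr = (\<lambda>X Y. \<Union>x\<in>X. \<Union>y\<in>Y. br x y +o N)\<rparr>"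


section \<open>Lie-derivations\<close>

definition lie_derivations ::
  "('k::field \<Rightarrow> 'v::ab_group_add \<Rightarrow> 'v) \<Rightarrow> ('v \<Rightarrow> 'v \<Rightarrow> 'v) \<Rightarrow> ('v \<Rightarrow> 'v) set" where
  "lie_derivations scale br =
     {d. Vector_Spaces.linear scale scale d \<and>
         (\<forall>x y. d (lie_br br x y) = lie_br br (d x) y + lie_br br x (d y))}"

definition almost_inner_lie_derivations ::
  "('k::field \<Rightarrow> 'v::ab_group_add \<Rightarrow> 'v) \<Rightarrow> ('v \<Rightarrow> 'v \<Rightarrow> 'v) \<Rightarrow> ('v \<Rightarrow> 'v) set" where
  "almost_inner_lie_derivations scale br =
     {d \<in> lie_derivations scale br. \<forall>x. d x \<in> range (lie_br br x)}"

definition Der_c_Lie ::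
  "('k::field \<Rightarrow> 'v::ab_group_add \<Rightarrow> 'v) \<Rightarrow> ('v \<Rightarrow> 'v \<Rightarrow> 'v) \<Rightarrow> ('k, 'v \<Rightarrow> 'v) alg" where
  "Der_c_Lie scale br =
     \<lparr>vecs = almost_inner_lie_derivations scale br,
      vadd = (\<lambda>a b x. a x + b x),
      vscale = (\<lambda>c a x. scale c (a x)),
      vbr = (\<lambda>a b x. a (b x) - b (a x))\<rparr>"


section \<open>Lie-isoclinism\<close>

definition lie_isoclinic ::
  "('k::field \<Rightarrow> 'v::ab_group_add \<Rightarrow> 'v) \<Rightarrow> ('v \<Rightarrow> 'v \<Rightarrow> 'v) \<Rightarrow>
   ('k \<Rightarrow> 'w::ab_group_add \<Rightarrow> 'w) \<Rightarrow> ('w \<Rightarrow> 'w \<Rightarrow> 'w) \<Rightarrow> bool" where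
  "lie_isoclinic sg bg sq bq \<longleftrightarrow>
     (\<exists>\<eta> \<xi>.
        alg_iso (quotient_alg sg bg (lie_center bg)) (quotient_alg sq bq (lie_center bq)) \<eta> \<and>
        alg_iso (sub_alg sg bg (lie_commutator sg bg)) (sub_alg sq bq (lie_commutator sq bq)) \<xi> \<and>
        (\<forall>x1 x2 y1 y2.
           \<eta> (x1 +o lie_center bg) = y1 +o lie_center bq \<and>
           \<eta> (x2 +o lie_center bg) = y2 +o lie_center bq \<longrightarrow>
           \<xi> (lie_br bg x1 x2) = lie_br bq y1 y2))"


section \<open>The quotients and ideals above are well defined\<close>

context leibniz_algebra
begin

lemma br_simps:
  "br (x + y) z = br x z + br y z" "br x (y + z) = br x y + br x z"
  "br (x - y) z = br x z - br y z" "br x (y - z) = br x y - br x z"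
  "br (- x) z = - br x z" "br x (- z) = - br x z"
  "br 0 z = 0" "br x 0 = 0"
  "br (scale c x) z = scale c (br x z)" "br x (scale c z) = scale c (br x z)"
proof -
  interpret l: Vector_Spaces.linear scale scale "\<lambda>x. br x y" for y by (rule linear_left)
  interpret r: Vector_Spaces.linear scale scale "\<lambda>y. br x y" for x by (rule linear_right)
  show "br (x + y) z = br x z + br y z" "br x (y + z) = br x y + br x z"
    "br (x - y) z = br x z - br y z" "br x (y - z) = br x y - br x z"
    "br (- x) z = - br x z" "br x (- z) = - br x z"
    "br 0 z = 0" "br x 0 = 0"
    "br (scale c x) z = scale c (br x z)" "br x (scale c z) = scale c (br x z)"
    by (simp_all add: l.add r.add l.diff r.diff l.neg r.neg l.zero r.zero l.scale r.scale)
qed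

lemma two_sided_ideal_lie_center: "two_sided_ideal scale br (lie_center br)"
proof -
  have Z: "br g z = - br z g" if "z \<in> lie_center br" for z g
    using that by (simp add: lie_center_def lie_br_def eq_neg_iff_add_eq_0)
  have sub: "subspace (lie_center br)"
    by (rule subspaceI)
      (auto simp: lie_center_def lie_br_def br_simps algebra_simps
        simp flip: scale_right_distrib)
  have 1: "br h z \<in> lie_center br" if z: "z \<in> lie_center br" for h z
  proof -
    have "lie_br br g (br h z) = 0" for g
    proof -
      have a: "br g (br h z) = br (br g h) z - br (br g z) h" by (rule leibniz_identity)
      have b: "br z (br h g) = br (br z h) g - br (br z g) h" by (rule leibniz_identity)
      have c: "br z (br g h) = br (br z g) h - br (br z h) g" by (rule leibniz_identity)
      show ?thesis
        using a b c by (simp add: lie_br_def Z[OF z] br_simps)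
    qed
    then show ?thesis by (simp add: lie_center_def)
  qed
  have 2: "br z h \<in> lie_center br" if z: "z \<in> lie_center br" for h z
    using subspace_neg[OF sub 1[OF z, of h]] by (simp add: Z[OF z])
  show ?thesis using sub 1 2 by (simp add: two_sided_ideal_def)
qed

lemma two_sided_ideal_lie_commutator: "two_sided_ideal scale br (lie_commutator scale br)"
  unfolding lie_commutator_def
proof (rule hull_in)
  fix T assume T: "\<forall>N\<in>T. two_sided_ideal scale br N"
  then have "subspace (\<Inter>T)"
    by (intro subspace_Inter) (auto simp: two_sided_ideal_def)
  with T show "two_sided_ideal scale br (\<Inter>T)"
    by (auto simp: two_sided_ideal_def)
qed

lemma coset_eq_iff:
  assumes "two_sided_ideal scale br N"
  shows "x +o N = y +o N \<longleftrightarrow> x - y \<in> N"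
proof -
  have N: "subspace N" using assms by (simp add: two_sided_ideal_def)
  show ?thesis
  proof
    assume e: "x +o N = y +o N"
    have "x \<in> x +o N" using subspace_0[OF N] by (force simp: elt_set_plus_def)
    then show "x - y \<in> N" unfolding e by (auto simp: elt_set_plus_def)
  next
    assume d: "x - y \<in> N"
    have "n + (x - y) \<in> N" "n - (x - y) \<in> N" if "n \<in> N" for n
      using that d subspace_add[OF N] subspace_diff[OF N] by auto
    then show "x +o N = y +o N"
      by (auto simp: elt_set_plus_def) (metis add_diff_eq add.commute diff_add_cancel,
          metis add.commute add_diff_cancel_left' add_diff_eq diff_diff_eq2)
  qed
qed

lemma UN_cosets:
  assumes N: "two_sided_ideal scale br N"
    and "\<And>n. n \<in> N \<Longrightarrow> F (x + n) = F x"
  shows "(\<Union>x\<in>x +o N. F x) = F x"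
proof -
  have "0 \<in> N" using N subspace_0 by (simp add: two_sided_ideal_def)
  then show ?thesis using assms(2) by (auto simp: elt_set_plus_def)
qed

lemma quotient_alg_simps:
  assumes N: "two_sided_ideal scale br N"
  shows "vadd (quotient_alg scale br N) (x +o N) (y +o N) = (x + y) +o N"
    and "vscale (quotient_alg scale br N) c (x +o N) = scale c x +o N"
    and "vbr (quotient_alg scale br N) (x +o N) (y +o N) = br x y +o N"
proof -
  have s: "subspace N" and i: "\<And>x n. n \<in> N \<Longrightarrow> br x n \<in> N" "\<And>x n. n \<in> N \<Longrightarrow> br n x \<in> N"
    using N by (auto simp: two_sided_ideal_def)
  note * = coset_eq_iff[OF N] subspace_scale[OF s] i
  show "vadd (quotient_alg scale br N) (x +o N) (y +o N) = (x + y) +o N"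
    by (simp add: quotient_alg_def UN_cosets[OF N] *)
  show "vscale (quotient_alg scale br N) c (x +o N) = scale c x +o N"
    by (simp add: quotient_alg_def UN_cosets[OF N] * scale_right_distrib)
  show "vbr (quotient_alg scale br N) (x +o N) (y +o N) = br x y +o N"
    by (simp add: quotient_alg_def UN_cosets[OF N] * br_simps)
qed

end

end

(*
  An almost inner Lie-derivation d kills the Lie-center Z and takes values in the Lie-commutator.
  So, given an isoclinism (\<eta>, \<xi>), the rule y \<mapsto> \<xi> (d x), where \<eta> (x + Z) = y + Z, is a well-defined
  map d'. Writing d x = [x, u]_lie, compatibility of \<eta> and \<xi> shows that d' is almost inner and that
  \<eta> (d x + Z) = d' y + Z. The latter makes d' a Lie-derivation and d \<mapsto> d' compatible with
  commutators; the inverse isoclinism gives the inverse map.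
*)
theory Submission
  imports Defs
begin

lemma lie_br_commute: "lie_br br x y = lie_br br y x"
  by (simp add: lie_br_def add.commute)

lemma lie_br_in_lie_commutator: "lie_br br x y \<in> lie_commutator scale br"
  unfolding lie_commutator_def by (rule subsetD[OF hull_subset]) blast

lemma (in leibniz_algebra) subspace_lie_commutator: "subspace (lie_commutator scale br)"
  using two_sided_ideal_lie_commutator by (simp add: two_sided_ideal_def)

section \<open>Transport of derivations along one direction of an isoclinism\<close>

text \<open>
  The relation \<open>R x y\<close> stands for \<open>\<eta> (x + Z) = y + Z\<close>. Only the properties of \<open>(\<eta>, \<xi>)\<close> needed to
  transport derivations from \<open>\<gg>\<close> to \<open>\<qq>\<close> are assumed, so that an isoclinism and its inverse are both
  instances.
\<close>
locale lie_isoclinism_hom =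
  g: leibniz_algebra sg bg + q: leibniz_algebra sq bq
  for sg :: "'k::field \<Rightarrow> 'g::ab_group_add \<Rightarrow> 'g" and bg :: "'g \<Rightarrow> 'g \<Rightarrow> 'g"
    and sq :: "'k \<Rightarrow> 'q::ab_group_add \<Rightarrow> 'q" and bq :: "'q \<Rightarrow> 'q \<Rightarrow> 'q" +
  fixes R :: "'g \<Rightarrow> 'q \<Rightarrow> bool" and \<xi> :: "'g \<Rightarrow> 'q"
  assumes R_total: "\<exists>y. R x y"
    and R_surj: "\<exists>x. R x y"
    and R_add: "R x y \<Longrightarrow> R x' y' \<Longrightarrow> R (x + x') (y + y')"
    and R_scale: "R x y \<Longrightarrow> R (sg c x) (sq c y)"
    and R_br: "R x y \<Longrightarrow> R x' y' \<Longrightarrow> R (bg x x') (bq y y')"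
    and R_inj: "R x y \<Longrightarrow> R x' y \<Longrightarrow> x - x' \<in> lie_center bg"
    and \<xi>_add: "a \<in> lie_commutator sg bg \<Longrightarrow> b \<in> lie_commutator sg bg \<Longrightarrow> \<xi> (a + b) = \<xi> a + \<xi> b"
    and \<xi>_scale: "a \<in> lie_commutator sg bg \<Longrightarrow> \<xi> (sg c a) = sq c (\<xi> a)"
    and \<xi>_lie_br: "R x y \<Longrightarrow> R x' y' \<Longrightarrow> \<xi> (lie_br bg x x') = lie_br bq y y'"
begin

text \<open>The representative chosen by \<open>SOME\<close> depends on \<open>y\<close> alone and
  not on \<open>d\<close>. Hence linearity in \<open>d\<close> can be read off by unfolding, without
  knowing that the sum or multiple is itself almost inner.\<close>

definition transport :: "('g \<Rightarrow> 'g) \<Rightarrow> 'q \<Rightarrow> 'q" where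
  "transport d y = \<xi> (d (SOME x. R x y))"

lemma R_lie_br: "R x y \<Longrightarrow> R x' y' \<Longrightarrow> R (lie_br bg x x') (lie_br bq y y')"
  by (simp add: lie_br_def R_add R_br)

lemma \<xi>_diff:
  assumes "a \<in> lie_commutator sg bg" "b \<in> lie_commutator sg bg"
  shows "\<xi> (a - b) = \<xi> a - \<xi> b"
  using \<xi>_add[of "a - b" b] assms g.subspace_diff[OF g.subspace_lie_commutator] by auto

context
  fixes d assumes d: "d \<in> almost_inner_lie_derivations sg bg"
begin

lemma linear: "Vector_Spaces.linear sg sg d"
  using d by (simp add: almost_inner_lie_derivations_def lie_derivations_def)

lemma deriv: "d (lie_br bg x y) = lie_br bg (d x) y + lie_br bg x (d y)"
  using d by (simp add: almost_inner_lie_derivations_def lie_derivations_def)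

lemma almost_inner: obtains u where "d x = lie_br bg x u"
  using d by (auto simp: almost_inner_lie_derivations_def)

lemma in_commutator: "d x \<in> lie_commutator sg bg"
  by (metis almost_inner lie_br_in_lie_commutator)

lemma d_simps: "d (x + y) = d x + d y" "d (x - y) = d x - d y" "d (sg c x) = sg c (d x)"
proof -
  interpret Vector_Spaces.linear sg sg d by (rule linear)
  show "d (x + y) = d x + d y" "d (x - y) = d x - d y" "d (sg c x) = sg c (d x)"
    by (rule add diff scale)+
qed

text \<open>Here almost innerness is essential: \<open>d z\<close> is a bracket of \<open>z\<close>
  with some element, and every such bracket vanishes.\<close>

lemma kills_center: "z \<in> lie_center bg \<Longrightarrow> d z = 0"
  by (rule almost_inner[of z]) (simp add: lie_center_def lie_br_commute)

text \<open>Two elements related to the same \<open>y\<close> differ by an element of the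
  Lie-center, which \<open>d\<close> kills, so any representative may replace the chosen
  one.\<close>

lemma transport_eq:
  assumes "R x y"
  shows "transport d y = \<xi> (d x)"
proof -
  have "R (SOME x. R x y) y" using assms by (rule someI)
  then have "d ((SOME x. R x y) - x) = 0" using assms by (intro kills_center R_inj)
  then show ?thesis by (simp add: transport_def d_simps)
qed

text \<open>With \<open>d x\<close> the bracket of \<open>x\<close> and \<open>u\<close>, and
  \<open>v\<close> related to \<open>u\<close>, compatibility of \<open>\<xi>\<close> turns
  \<open>transport d y\<close> into the bracket of \<open>y\<close> and \<open>v\<close>; brackets
  of related elements are related.\<close>

lemma R_transport:
  assumes "R x y"
  shows "R (d x) (transport d y)"
proof -
  obtain u where u: "d x = lie_br bg x u" by (rule almost_inner)
  obtain v where "R u v" using R_total by blast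
  then show ?thesis
    using assms by (simp add: transport_eq[OF assms] u \<xi>_lie_br[of x y u v] R_lie_br)
qed

lemma transport_almost_inner: "transport d \<in> almost_inner_lie_derivations sq bq"
proof -
  have "Vector_Spaces.linear sq sq (transport d)"
    unfolding Vector_Spaces.linear_iff
  proof (intro conjI allI)
    fix y y' c
    obtain x x' where x: "R x y" "R x' y'" using R_surj by meson
    show "transport d (y + y') = transport d y + transport d y'"
      using x by (simp add: transport_eq R_add[OF x] transport_eq[OF R_add[OF x]] d_simps \<xi>_add
          in_commutator)
    show "transport d (sq c y) = sq c (transport d y)"
      using x by (simp add: transport_eq transport_eq[OF R_scale[OF x(1)]] d_simps \<xi>_scale
          in_commutator)
  qed (rule q.vector_space_axioms)+
  moreover have "transport d (lie_br bq y y')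
      = lie_br bq (transport d y) y' + lie_br bq y (transport d y')" for y y'
  proof -
    obtain x x' where x: "R x y" "R x' y'" using R_surj by meson
    have "transport d (lie_br bq y y') = \<xi> (lie_br bg (d x) x' + lie_br bg x (d x'))"
      by (simp add: transport_eq[OF R_lie_br[OF x]] deriv)
    \<comment> \<open>\<open>R_transport\<close> relates \<open>d x\<close> to
      \<open>transport d y\<close>, so compatibility of \<open>\<xi>\<close> applies to each summand
      separately.\<close>
    also have "\<dots> = lie_br bq (transport d y) y' + lie_br bq y (transport d y')"
      using x by (simp add: \<xi>_add lie_br_in_lie_commutator \<xi>_lie_br[OF R_transport]
          \<xi>_lie_br[OF _ R_transport])
    finally show ?thesis .
  qed
  moreover have "transport d y \<in> range (lie_br bq y)" for y
  proof -
    obtain x where x: "R x y" using R_surj by blast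
    obtain u where u: "d x = lie_br bg x u" by (rule almost_inner)
    obtain v where "R u v" using R_total by blast
    then show ?thesis using x by (simp add: transport_eq u \<xi>_lie_br[of x y u v])
  qed
  ultimately show ?thesis
    by (simp add: almost_inner_lie_derivations_def lie_derivations_def)
qed

lemma transport_scale: "transport (\<lambda>x. sg c (d x)) = (\<lambda>y. sq c (transport d y))"
  by (simp add: transport_def fun_eq_iff \<xi>_scale in_commutator)

end

lemma transport_add:
  assumes "d \<in> almost_inner_lie_derivations sg bg" "e \<in> almost_inner_lie_derivations sg bg"
  shows "transport (\<lambda>x. d x + e x) = (\<lambda>y. transport d y + transport e y)"
  using assms by (simp add: transport_def fun_eq_iff \<xi>_add in_commutator)

text \<open>The commutator of \<open>d\<close> and \<open>e\<close> is not assumed to be almost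
  inner, so \<open>transport_eq\<close> is not applied to it. Instead both composites on the right
  are computed at the chosen representative of \<open>y\<close>, since \<open>R_transport\<close>
  carries the relation through the inner derivation.\<close>

lemma transport_commutator:
  assumes d: "d \<in> almost_inner_lie_derivations sg bg" and e: "e \<in> almost_inner_lie_derivations sg bg"
  shows "transport (\<lambda>x. d (e x) - e (d x)) =
    (\<lambda>y. transport d (transport e y) - transport e (transport d y))"
proof
  fix y
  have x: "R (SOME x. R x y) y" using R_surj by (rule someI_ex)
  show "transport (\<lambda>x. d (e x) - e (d x)) y =
      transport d (transport e y) - transport e (transport d y)"
    unfolding transport_eq[OF d R_transport[OF e x]] transport_eq[OF e R_transport[OF d x]]
    by (simp add: transport_def \<xi>_diff in_commutator d e)
qed

end

section \<open>Mutually inverse transports\<close>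

lemma transport_inverse:
  assumes 1: "lie_isoclinism_hom sg bg sq bq R \<xi>"
    and 2: "lie_isoclinism_hom sq bq sg bg (\<lambda>y x. R x y) \<zeta>"
    and inv: "\<And>a. a \<in> lie_commutator sg bg \<Longrightarrow> \<zeta> (\<xi> a) = a"
    and d: "d \<in> almost_inner_lie_derivations sg bg"
  shows "lie_isoclinism_hom.transport (\<lambda>y x. R x y) \<zeta> (lie_isoclinism_hom.transport R \<xi> d) = d"
proof
  interpret A: lie_isoclinism_hom sg bg sq bq R \<xi> by (rule 1)
  interpret B: lie_isoclinism_hom sq bq sg bg "\<lambda>y x. R x y" \<zeta> by (rule 2)
  fix x
  obtain y where "R x y" using A.R_total by blast
  \<comment> \<open>Evaluated at related \<open>x\<close> and \<open>y\<close>, the double transport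
    is \<open>\<zeta> (\<xi> (d x))\<close>, and \<open>d x\<close> lies in the
    Lie-commutator.\<close>
  then show "B.transport (A.transport d) x = d x"
    by (simp add: B.transport_eq[OF A.transport_almost_inner[OF d]] A.transport_eq[OF d] inv
        A.in_commutator[OF d])
qed

lemma alg_iso_Der_c_Lie:
  assumes 1: "lie_isoclinism_hom sg bg sq bq R \<xi>"
    and 2: "lie_isoclinism_hom sq bq sg bg (\<lambda>y x. R x y) \<zeta>"
    and inv1: "\<And>a. a \<in> lie_commutator sg bg \<Longrightarrow> \<zeta> (\<xi> a) = a"
    and inv2: "\<And>b. b \<in> lie_commutator sq bq \<Longrightarrow> \<xi> (\<zeta> b) = b"
  shows "alg_iso (Der_c_Lie sg bg) (Der_c_Lie sq bq) (lie_isoclinism_hom.transport R \<xi>)"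
proof -
  interpret A: lie_isoclinism_hom sg bg sq bq R \<xi> by (rule 1)
  interpret B: lie_isoclinism_hom sq bq sg bg "\<lambda>y x. R x y" \<zeta> by (rule 2)
  note BA = transport_inverse[OF 1 2 inv1] and AB = transport_inverse[OF 2 1 inv2]
  have "bij_betw A.transport (almost_inner_lie_derivations sg bg) (almost_inner_lie_derivations sq bq)"
    by (rule bij_betw_byWitness[of _ B.transport])
      (auto simp: BA AB A.transport_almost_inner B.transport_almost_inner)
  moreover have "(\<lambda>x. d (e x) - e (d x)) \<in> almost_inner_lie_derivations sg bg \<longleftrightarrow>
      A.transport (\<lambda>x. d (e x) - e (d x)) \<in> almost_inner_lie_derivations sq bq"
    if "d \<in> almost_inner_lie_derivations sg bg" "e \<in> almost_inner_lie_derivations sg bg" for d e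
  proof
    \<comment> \<open>\<open>BA\<close> cannot be applied to the commutator before it is known to be
      almost inner. Both transports are moved inside it first, and \<open>BA\<close> is then used on
      \<open>d\<close> and \<open>e\<close>.\<close>
    assume "A.transport (\<lambda>x. d (e x) - e (d x)) \<in> almost_inner_lie_derivations sq bq"
    then have "B.transport (A.transport (\<lambda>x. d (e x) - e (d x)))
        \<in> almost_inner_lie_derivations sg bg"
      by (rule B.transport_almost_inner)
    then show "(\<lambda>x. d (e x) - e (d x)) \<in> almost_inner_lie_derivations sg bg"
      using that
      by (simp add: A.transport_commutator B.transport_commutator A.transport_almost_inner BA)
  qed (rule A.transport_almost_inner)
  ultimately show ?thesis
    by (simp add: alg_iso_def Der_c_Lie_def A.transport_add A.transport_scale
        A.transport_commutator)
qed

section \<open>From an isoclinism to a pair of mutually inverse transport data\<close>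

lemma lie_isoclinic_imp_homs:
  fixes sg :: "'k::field \<Rightarrow> 'g::ab_group_add \<Rightarrow> 'g" and bg :: "'g \<Rightarrow> 'g \<Rightarrow> 'g"
    and sq :: "'k \<Rightarrow> 'q::ab_group_add \<Rightarrow> 'q" and bq :: "'q \<Rightarrow> 'q \<Rightarrow> 'q"
  assumes "leibniz_algebra sg bg" and "leibniz_algebra sq bq" and "lie_isoclinic sg bg sq bq"
  obtains R \<xi> \<zeta> where "lie_isoclinism_hom sg bg sq bq R \<xi>"
    and "lie_isoclinism_hom sq bq sg bg (\<lambda>y x. R x y) \<zeta>"
    and "\<And>a. a \<in> lie_commutator sg bg \<Longrightarrow> \<zeta> (\<xi> a) = a"
    and "\<And>b. b \<in> lie_commutator sq bq \<Longrightarrow> \<xi> (\<zeta> b) = b"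
proof -
  interpret g: leibniz_algebra sg bg by fact
  interpret q: leibniz_algebra sq bq by fact
  let ?Z = "lie_center bg" and ?Z' = "lie_center bq"
  let ?C = "lie_commutator sg bg" and ?C' = "lie_commutator sq bq"
  obtain \<eta> \<xi> where \<eta>: "alg_iso (quotient_alg sg bg ?Z) (quotient_alg sq bq ?Z') \<eta>"
    and \<xi>: "alg_iso (sub_alg sg bg ?C) (sub_alg sq bq ?C') \<xi>"
    and compat: "\<And>x1 x2 y1 y2. \<eta> (x1 +o ?Z) = y1 +o ?Z' \<Longrightarrow> \<eta> (x2 +o ?Z) = y2 +o ?Z' \<Longrightarrow>
      \<xi> (lie_br bg x1 x2) = lie_br bq y1 y2"
    using \<open>lie_isoclinic sg bg sq bq\<close> unfolding lie_isoclinic_def by metis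
  \<comment> \<open>As a relation on elements, \<open>\<eta>\<close> is inverted by swapping
    arguments, with no choice of coset representatives.\<close>
  define R where "R x y \<longleftrightarrow> \<eta> (x +o ?Z) = y +o ?Z'" for x y
  define \<zeta> where "\<zeta> = inv_into ?C \<xi>"
  note Zg = g.two_sided_ideal_lie_center and Zq = q.two_sided_ideal_lie_center
  have vecs: "vecs (quotient_alg sg bg ?Z) = range (\<lambda>x. x +o ?Z)"
    "vecs (quotient_alg sq bq ?Z') = range (\<lambda>x. x +o ?Z')"
    by (simp_all add: quotient_alg_def)
  have bij\<eta>: "bij_betw \<eta> (range (\<lambda>x. x +o ?Z)) (range (\<lambda>x. x +o ?Z'))"
    using \<eta> by (simp add: alg_iso_def vecs)
  have bij\<xi>: "bij_betw \<xi> ?C ?C'"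
    and \<xi>_add: "\<And>a b. a \<in> ?C \<Longrightarrow> b \<in> ?C \<Longrightarrow> \<xi> (a + b) = \<xi> a + \<xi> b"
    and \<xi>_scale: "\<And>c a. a \<in> ?C \<Longrightarrow> \<xi> (sg c a) = sq c (\<xi> a)"
    using \<xi> by (auto simp: alg_iso_def sub_alg_def)
  have \<zeta>\<xi>: "\<zeta> (\<xi> a) = a" if "a \<in> ?C" for a
    unfolding \<zeta>_def using bij\<xi> that by (rule bij_betw_inv_into_left)
  have \<xi>\<zeta>: "\<xi> (\<zeta> b) = b" if "b \<in> ?C'" for b
    unfolding \<zeta>_def using bij\<xi> that by (rule bij_betw_inv_into_right)
  have \<zeta>_C: "\<zeta> b \<in> ?C" if "b \<in> ?C'" for b
    unfolding \<zeta>_def using bij_betw_inv_into[OF bij\<xi>] that by (rule bij_betwE[THEN bspec])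
  have R_total: "\<exists>y. R x y" for x
    using bij_betw_imp_surj_on[OF bij\<eta>] unfolding R_def by blast
  have R_surj: "\<exists>x. R x y" for y
  proof -
    have "y +o ?Z' \<in> \<eta> ` range (\<lambda>x. x +o ?Z)"
      using bij_betw_imp_surj_on[OF bij\<eta>] by blast
    then show ?thesis unfolding R_def by auto
  qed
  have R_inj: "x - x' \<in> ?Z" if "R x y" "R x' y" for x x' y
    using inj_onD[OF bij_betw_imp_inj_on[OF bij\<eta>] _ rangeI rangeI, of x x'] that
    by (simp add: R_def g.coset_eq_iff[OF Zg])
  \<comment> \<open>This serves as the injectivity axiom for the swapped relation.\<close>
  have R_fun: "y - y' \<in> ?Z'" if "R x y" "R x y'" for x y y'
    using that by (simp add: R_def flip: q.coset_eq_iff[OF Zq])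
  have R_add: "R (x + x') (y + y')" if "R x y" "R x' y'" for x x' y y'
    using that \<eta> by (simp add: R_def alg_iso_def vecs g.quotient_alg_simps[OF Zg]
        q.quotient_alg_simps[OF Zq])
  have R_scale: "R (sg c x) (sq c y)" if "R x y" for x y c
    using that \<eta> by (simp add: R_def alg_iso_def vecs g.quotient_alg_simps[OF Zg]
        q.quotient_alg_simps[OF Zq])
  have R_br: "R (bg x x') (bq y y')" if "R x y" "R x' y'" for x x' y y'
    using that \<eta> by (simp add: R_def alg_iso_def vecs g.quotient_alg_simps[OF Zg]
        q.quotient_alg_simps[OF Zq])
  have \<xi>_lie_br: "\<xi> (lie_br bg x x') = lie_br bq y y'" if "R x y" "R x' y'" for x x' y y'
    using that compat by (simp add: R_def)
  show thesis
  proof (rule that[OF _ _ \<zeta>\<xi> \<xi>\<zeta>])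
    show "lie_isoclinism_hom sg bg sq bq R \<xi>"
      by unfold_locales (fact R_total R_surj R_add R_scale R_br R_inj \<xi>_add \<xi>_scale \<xi>_lie_br)+
    show "lie_isoclinism_hom sq bq sg bg (\<lambda>y x. R x y) \<zeta>"
    proof unfold_locales
      fix a b c assume a: "a \<in> ?C'"
      show "\<zeta> (sq c a) = sg c (\<zeta> a)"
        \<comment> \<open>Linearity of the inverse: \<open>\<xi>\<close> sends
          \<open>sg c (\<zeta> a)\<close> to \<open>sq c a\<close>, and \<open>\<zeta>\<close>
          undoes \<open>\<xi>\<close> because \<open>?C\<close> is a subspace containing
          \<open>sg c (\<zeta> a)\<close>.\<close>
        using \<zeta>\<xi>[of "sg c (\<zeta> a)"] a
        by (simp add: \<xi>_scale \<zeta>_C \<xi>\<zeta> g.subspace_scale[OF g.subspace_lie_commutator])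
      assume b: "b \<in> ?C'"
      show "\<zeta> (a + b) = \<zeta> a + \<zeta> b"
        using \<zeta>\<xi>[of "\<zeta> a + \<zeta> b"] a b
        by (simp add: \<xi>_add \<zeta>_C \<xi>\<zeta> g.subspace_add[OF g.subspace_lie_commutator])
    next
      fix x x' y y' assume "R x y" "R x' y'"
      then show "\<zeta> (lie_br bq y y') = lie_br bg x x'"
        using \<zeta>\<xi>[OF lie_br_in_lie_commutator, of x x'] by (simp add: \<xi>_lie_br[of x y x' y'])
    qed (fact R_total R_surj R_add R_scale R_br R_fun)+
  qed
qed

theorem corollary5p5:
  fixes sg :: "'k::field \<Rightarrow> 'g::ab_group_add \<Rightarrow> 'g" and bg :: "'g \<Rightarrow> 'g \<Rightarrow> 'g"
    and sq :: "'k \<Rightarrow> 'q::ab_group_add \<Rightarrow> 'q" and bq :: "'q \<Rightarrow> 'q \<Rightarrow> 'q"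
  assumes half: "(2::'k) \<noteq> 0"
    and g: "leibniz_algebra sg bg"
    and q: "leibniz_algebra sq bq"
    and isoclinic: "lie_isoclinic sg bg sq bq"
  shows "isomorphic_alg (Der_c_Lie sg bg) (Der_c_Lie sq bq)"
proof (rule lie_isoclinic_imp_homs[OF g q isoclinic])
  show "isomorphic_alg (Der_c_Lie sg bg) (Der_c_Lie sq bq)"
    if "lie_isoclinism_hom sg bg sq bq R \<xi>"
      and "lie_isoclinism_hom sq bq sg bg (\<lambda>y x. R x y) \<zeta>"
      and "\<And>a. a \<in> lie_commutator sg bg \<Longrightarrow> \<zeta> (\<xi> a) = a"
      and "\<And>b. b \<in> lie_commutator sq bq \<Longrightarrow> \<xi> (\<zeta> b) = b" for R \<xi> \<zeta>
    unfolding isomorphic_alg_def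
    by (rule exI, rule alg_iso_Der_c_Lie[OF that(1,2)]) (simp_all add: that(3,4))
qed

end
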